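(* Let $f:\mathbb{Z}_N\to\mathbb{C}$ be nonzero and let $\eta>0$. Then for any integer $k$ such that $$k>\frac{\mathrm{FR}(f)^2-1}{\eta^2},$$ there exists a trigonometric polynomial $$P(x)=\sum_{i=1}^k c_i\,\chi(m_i x)\qquad(c_i\in\mathbb{C},\ m_i\in\mathbb{Z}_N)$$ such that $$\|f-P\|_2<\eta\,\|f\|_2 .$$
   Context: $N$ is a positive integer, $\mathbb{Z}_N=\mathbb{Z}/N\mathbb{Z}$, $\chi(t)=e^{2\pi i t/N}$. For $f:\mathbb{Z}_N\to\mathbb{C}$ the unitary Fourier transform is $\widehat f(m)=N^{-1/2}\sum_{x\in\mathbb{Z}_N}\chi(-xm)f(x)$. $\|g\|_p=\left(\sum_{x\in\mathbb{Z}_N}|g(x)|^p\right)^{1/p}$. The Fourier ratio of a nonzero $f$ is $\mathrm{FR}(f)=\|\widehat f\|_1/\|\widehat f\|_2$. *)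

theory Defs
  imports "HOL-Analysis.Analysis" "HOL-Number_Theory.Residues"
begin

text \<open>
  Elements of \<open>\<int>/N\<int>\<close> are the representatives \<open>0, \<dots>, N - 1\<close>, i.e. the carrier of the library's
  residue ring; this also covers \<open>N = 1\<close>. A function on \<open>\<int>/N\<int>\<close> is a function on \<open>int\<close> of which
  only the values on this carrier matter.
\<close>

definition ZN :: "nat \<Rightarrow> int set" where
  "ZN N = carrier (residue_ring (int N))"

lemma ZN_eq: "ZN N = {0..<int N}"
  by (auto simp: ZN_def residue_ring_def)

definition chi :: "nat \<Rightarrow> int \<Rightarrow> complex" where
  "chi N t = exp (2 * of_real pi * \<i> * of_int t / of_nat N)"

text \<open>
  By the next lemma, \<open>chi N\<close> descends to residue classes, so products such as \<open>m * x\<close> in its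
  argument may be taken in the integers.
\<close>

lemma chi_cong:
  assumes "N > 0" "[s = t] (mod int N)"
  shows "chi N s = chi N t"
proof -
  from assms(2) obtain k where k: "s = t + int N * k"
    by (metis cong_iff_lin cong_sym)
  have "2 * of_real pi * \<i> * of_int s / of_nat N
      = 2 * of_real pi * \<i> * of_int t / of_nat N + 2 * of_int k * of_real pi * (\<i>::complex)"
    using assms(1) by (simp add: k field_simps)
  moreover have "exp (2 * of_int k * of_real pi * \<i>) = (1::complex)"
    using exp_integer_2pi[of "of_int k"] by simp
  ultimately show ?thesis
    by (simp add: chi_def exp_add)
qed

definition fourier :: "nat \<Rightarrow> (int \<Rightarrow> complex) \<Rightarrow> int \<Rightarrow> complex" where
  "fourier N f m = of_real (real N powr (- 1 / 2)) * (\<Sum>x\<in>ZN N. chi N (- (x * m)) * f x)"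

definition lp_norm :: "nat \<Rightarrow> real \<Rightarrow> (int \<Rightarrow> complex) \<Rightarrow> real" where
  "lp_norm N p g = (\<Sum>x\<in>ZN N. norm (g x) powr p) powr (1 / p)"

definition fourier_ratio :: "nat \<Rightarrow> (int \<Rightarrow> complex) \<Rightarrow> real" where
  "fourier_ratio N f = lp_norm N 1 (fourier N f) / lp_norm N 2 (fourier N f)"

end

theory Submission
  imports Defs
begin

text \<open>
  Write \<open>a = fourier N f\<close> and \<open>A = \<parallel>a\<parallel>\<^sub>1\<close>. By Fourier inversion \<open>f\<close> is the convex combination, with
  weights \<open>\<bar>a m\<bar> / A\<close>, of the functions \<open>v\<^sub>m(x) = A sgn (a m) N\<^sup>-\<^sup>1\<^sup>/\<^sup>2 \<chi>(m x)\<close>, whose norm in \<open>\<ell>\<^sup>2\<close> is at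
  most \<open>A\<close>. Maurey's empirical method approximates \<open>f\<close> by the mean of \<open>k\<close> independent samples
  of \<open>v\<^sub>m\<close>, with expected squared error at most \<open>(A\<^sup>2 - \<parallel>f\<parallel>\<^sup>2) / k = (FR(f)\<^sup>2 - 1) \<parallel>f\<parallel>\<^sup>2 / k\<close>.
  The samples can be chosen one after another: the expected increase of the squared norm of
  \<open>\<Sum>\<^sub>i (v\<^bsub>m\<^sub>i\<^esub> - f)\<close> in one step does not depend on the earlier choices, because \<open>v\<^sub>m - f\<close> has
  mean zero.
\<close>

section \<open>Maurey's empirical method\<close>

lemma sum_weighted_norm_sq_shift:
  fixes v :: "'i \<Rightarrow> 'a::real_inner"
  assumes "sum p I = 1"
  defines "u \<equiv> (\<Sum>i\<in>I. p i *\<^sub>R v i)"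
  shows "(\<Sum>i\<in>I. p i * (norm (s + v i - u))\<^sup>2) = (norm s)\<^sup>2 + (\<Sum>i\<in>I. p i * (norm (v i))\<^sup>2) - (norm u)\<^sup>2"
proof -
  have "(\<Sum>i\<in>I. p i * (norm (s + v i - u))\<^sup>2)
      = (\<Sum>i\<in>I. p i * (norm (s - u))\<^sup>2 + 2 * ((s - u) \<bullet> (p i *\<^sub>R v i)) + p i * (norm (v i))\<^sup>2)"
    by (intro sum.cong)
       (simp_all add: power2_norm_eq_inner inner_simps inner_commute algebra_simps)
  also have "\<dots> = (norm (s - u))\<^sup>2 + 2 * ((s - u) \<bullet> u) + (\<Sum>i\<in>I. p i * (norm (v i))\<^sup>2)"
    by (simp only: sum.distrib flip: sum_distrib_right sum_distrib_left inner_sum_right)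
       (simp add: assms)
  \<comment> \<open>Since \<open>norm (s - u)\<close> squared plus twice the inner product of
    \<open>s - u\<close> with \<open>u\<close> equals \<open>norm s\<close> squared minus
    \<open>norm u\<close> squared, no mixed term in \<open>s\<close> remains.\<close>
  finally show ?thesis
    by (simp add: power2_norm_eq_inner inner_simps inner_commute)
qed

lemma weighted_average_ge_some:
  fixes p q :: "'i \<Rightarrow> real"
  assumes "\<And>i. i \<in> I \<Longrightarrow> p i \<ge> 0" "sum p I = 1" "(\<Sum>i\<in>I. p i * q i) \<le> B"
  shows "\<exists>i\<in>I. q i \<le> B"
proof (rule ccontr)
  assume "\<not> ?thesis"
  then have gt: "q i > B" if "i \<in> I" for i
    using that by force
  \<comment> \<open>Total weight 1 forces both facts: a sum over an infinite set is 0 by default,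
    and so is a sum of zero weights.\<close>
  obtain j where j: "j \<in> I" "p j > 0" and fin: "finite I"
    using assms(1,2) by (metis less_eq_real_def sum.infinite sum.neutral zero_neq_one)
  have "(\<Sum>i\<in>I. p i * B) < (\<Sum>i\<in>I. p i * q i)"
    using j fin by (intro sum_strict_mono_ex1) (auto intro!: mult_left_mono bexI[of _ j] simp: assms(1) less_imp_le gt)
  then show False
    using assms(2,3) by (simp flip: sum_distrib_right)
qed

text \<open>Induction on the number of samples. Keeping the sum of deviations instead of the mean
  makes every step add at most the same constant, \<open>B\<close> minus the squared norm of
  \<open>f\<close>.\<close>

lemma maurey_empirical:
  fixes v :: "'i \<Rightarrow> 'x \<Rightarrow> 'a::real_inner"
  assumes "\<And>i. i \<in> I \<Longrightarrow> p i \<ge> 0" "sum p I = 1"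
    and f: "\<And>x. x \<in> X \<Longrightarrow> f x = (\<Sum>i\<in>I. p i *\<^sub>R v i x)"
    and bound: "\<And>i. i \<in> I \<Longrightarrow> (\<Sum>x\<in>X. (norm (v i x))\<^sup>2) \<le> B"
  shows "\<exists>m. (\<forall>j. m j \<in> I) \<and>
    (\<Sum>x\<in>X. (norm (\<Sum>j<n. v (m j) x - f x))\<^sup>2) \<le> real n * (B - (\<Sum>x\<in>X. (norm (f x))\<^sup>2))"
proof (induction n)
  case 0
  \<comment> \<open>Even with no samples drawn, \<open>m\<close> must take values in
    \<open>I\<close> at every index.\<close>
  have "I \<noteq> {}"
    using assms(2) by auto
  then show ?case
    by auto
next
  case (Suc n)
  then obtain m where m: "\<And>j. m j \<in> I" and
    le: "(\<Sum>x\<in>X. (norm (\<Sum>j<n. v (m j) x - f x))\<^sup>2) \<le> real n * (B - (\<Sum>x\<in>X. (norm (f x))\<^sup>2))"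
    by blast
  define s where "s x = (\<Sum>j<n. v (m j) x - f x)" for x
  have "(\<Sum>i\<in>I. p i * (\<Sum>x\<in>X. (norm (s x + v i x - f x))\<^sup>2))
      = (\<Sum>x\<in>X. \<Sum>i\<in>I. p i * (norm (s x + v i x - f x))\<^sup>2)"
    unfolding sum_distrib_left by (rule sum.swap)
  also have "\<dots> = (\<Sum>x\<in>X. (norm (s x))\<^sup>2 + (\<Sum>i\<in>I. p i * (norm (v i x))\<^sup>2) - (norm (f x))\<^sup>2)"
    using assms(2) by (intro sum.cong refl) (simp add: f sum_weighted_norm_sq_shift)
  also have "\<dots> = (\<Sum>x\<in>X. (norm (s x))\<^sup>2) + (\<Sum>i\<in>I. p i * (\<Sum>x\<in>X. (norm (v i x))\<^sup>2))
                  - (\<Sum>x\<in>X. (norm (f x))\<^sup>2)"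
    unfolding sum_distrib_left by (simp add: sum.distrib sum_subtractf sum.swap[of _ X])
  also have "(\<Sum>i\<in>I. p i * (\<Sum>x\<in>X. (norm (v i x))\<^sup>2)) \<le> (\<Sum>i\<in>I. p i * B)"
    by (intro sum_mono mult_left_mono bound assms(1))
  also have "\<dots> = B"
    using assms(2) by (simp flip: sum_distrib_right)
  finally have avg: "(\<Sum>i\<in>I. p i * (\<Sum>x\<in>X. (norm (s x + v i x - f x))\<^sup>2))
      \<le> (\<Sum>x\<in>X. (norm (s x))\<^sup>2) + B - (\<Sum>x\<in>X. (norm (f x))\<^sup>2)"
    by simp
  obtain i where i: "i \<in> I" and
    step: "(\<Sum>x\<in>X. (norm (s x + v i x - f x))\<^sup>2) \<le> (\<Sum>x\<in>X. (norm (s x))\<^sup>2) + B - (\<Sum>x\<in>X. (norm (f x))\<^sup>2)"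
    using weighted_average_ge_some[OF assms(1,2) avg] by blast
  \<comment> \<open>Overriding \<open>m\<close> at \<open>n\<close> leaves the first
    \<open>n\<close> samples unchanged.\<close>
  have "(\<Sum>j<Suc n. v ((m(n := i)) j) x - f x) = s x + v i x - f x" for x
    by (simp add: s_def)
  then show ?case
    using m i le step by (intro exI[of _ "m(n := i)"]) (simp add: s_def algebra_simps)
qed

section \<open>Characters, Fourier inversion and Parseval\<close>

lemma finite_ZN [simp]: "finite (ZN N)"
  by (simp add: ZN_eq)

lemma chi_eq_cis: "chi N t = cis (2 * pi * real_of_int t / real N)"
  by (simp add: chi_def cis_conv_exp mult_ac)

lemma norm_chi [simp]: "norm (chi N t) = 1"
  by (simp add: chi_eq_cis)

lemma cnj_chi: "cnj (chi N t) = chi N (- t)"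
  by (simp add: chi_eq_cis cis_cnj)

lemma chi_add: "chi N (s + t) = chi N s * chi N t"
  by (simp add: chi_eq_cis cis_mult add_divide_distrib distrib_left)

lemma chi_power: "chi N t ^ n = chi N (t * int n)"
  by (simp add: chi_eq_cis Complex.DeMoivre mult_ac)

lemma chi_eq_1_iff:
  assumes "N > 0"
  shows "chi N t = 1 \<longleftrightarrow> int N dvd t"
proof
  assume "chi N t = 1"
  then obtain n :: int where "2 * pi * real_of_int t / real N = real_of_int (2 * n) * pi"
    by (auto simp: chi_def exp_eq_1)
  then have "real_of_int t = real_of_int (int N * n)"
    using assms by (simp add: field_simps)
  then show "int N dvd t"
    by (metis dvd_triv_left of_int_eq_iff)
next
  assume "int N dvd t"
  then have "chi N t = chi N 0"
    using assms by (intro chi_cong) (auto simp: cong_0_iff)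
  then show "chi N t = 1"
    by (simp add: chi_def)
qed

text \<open>Orthogonality of characters: a geometric sum whose ratio \<open>chi N t\<close> has
  \<open>N\<close>-th power 1, so it vanishes unless the ratio is 1.\<close>

lemma sum_chi:
  assumes "N > 0"
  shows "(\<Sum>m\<in>ZN N. chi N (t * m)) = (if int N dvd t then of_nat N else 0)"
proof -
  have "ZN N = int ` {..<N}"
    by (simp add: ZN_eq image_int_atLeastLessThan lessThan_atLeast0)
  then have "(\<Sum>m\<in>ZN N. chi N (t * m)) = (\<Sum>j<N. chi N t ^ j)"
    by (simp add: sum.reindex chi_power)
  also have "\<dots> = (if int N dvd t then of_nat N else 0)"
    using chi_eq_1_iff[OF assms, of t] chi_eq_1_iff[OF assms, of "t * int N"]
    by (auto simp: geometric_sum chi_power[of N t N])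
  finally show ?thesis .
qed

lemma powr_minus_half_sq:
  assumes "N > 0"
  shows "(real N powr (- 1 / 2))\<^sup>2 = 1 / real N"
  using assms by (simp add: power2_eq_square powr_minus_divide flip: powr_add)

lemma fourier_inversion:
  assumes "N > 0" "x \<in> ZN N"
  shows "f x = of_real (real N powr (- 1 / 2)) * (\<Sum>m\<in>ZN N. fourier N f m * chi N (m * x))"
proof -
  let ?r = "complex_of_real (real N powr (- 1 / 2))"
  have r: "?r * ?r = 1 / of_nat N"
    using powr_minus_half_sq[OF assms(1)] by (metis of_real_1 of_real_divide of_real_mult of_real_of_nat_eq power2_eq_square)
  have "?r * (\<Sum>m\<in>ZN N. fourier N f m * chi N (m * x))
      = ?r * ?r * (\<Sum>m\<in>ZN N. \<Sum>y\<in>ZN N. f y * (chi N (- (y * m)) * chi N (m * x)))"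
    by (simp add: fourier_def sum_distrib_left sum_distrib_right mult_ac)
  also have "\<dots> = ?r * ?r * (\<Sum>y\<in>ZN N. \<Sum>m\<in>ZN N. f y * (chi N (- (y * m)) * chi N (m * x)))"
    by (subst sum.swap) (rule refl)
  also have "\<dots> = ?r * ?r * (\<Sum>y\<in>ZN N. f y * (\<Sum>m\<in>ZN N. chi N ((x - y) * m)))"
    by (simp add: sum_distrib_left algebra_simps flip: chi_add)
  also have "(\<Sum>y\<in>ZN N. f y * (\<Sum>m\<in>ZN N. chi N ((x - y) * m))) = (\<Sum>y\<in>ZN N. if y = x then of_nat N * f y else 0)"
  proof (intro sum.cong refl)
    fix y assume "y \<in> ZN N"
    \<comment> \<open>Both are representatives in \<open>0, ..., N - 1\<close>, so congruence means
      equality.\<close>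
    then have "int N dvd x - y \<longleftrightarrow> y = x"
      using assms(2) by (auto simp: ZN_eq mod_eq_dvd_iff[symmetric])
    then show "f y * (\<Sum>m\<in>ZN N. chi N ((x - y) * m)) = (if y = x then of_nat N * f y else 0)"
      using assms(1) by (simp add: sum_chi)
  qed
  also have "\<dots> = of_nat N * f x"
    using assms(2) by simp
  finally show ?thesis
    using assms(1) by (simp only: r) simp
qed

lemma parseval:
  assumes "N > 0"
  shows "(\<Sum>m\<in>ZN N. (norm (fourier N f m))\<^sup>2) = (\<Sum>x\<in>ZN N. (norm (f x))\<^sup>2)"
proof -
  let ?r = "complex_of_real (real N powr (- 1 / 2))"
  have "complex_of_real (\<Sum>x\<in>ZN N. (norm (f x))\<^sup>2) = (\<Sum>x\<in>ZN N. f x * cnj (f x))"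
    by (simp only: complex_norm_square of_real_sum)
  \<comment> \<open>Inversion is applied to the factor \<open>f x\<close> only; after the exchange
    of sums, the factor \<open>cnj (f x)\<close> builds up the conjugate of
    \<open>fourier N f m\<close>.\<close>
  also have "\<dots> = (\<Sum>x\<in>ZN N. ?r * (\<Sum>m\<in>ZN N. fourier N f m * chi N (m * x)) * cnj (f x))"
    using fourier_inversion[OF assms, of _ f] by (intro sum.cong refl arg_cong2[of _ _ _ _ "(*)"])
  also have "\<dots> = (\<Sum>x\<in>ZN N. \<Sum>m\<in>ZN N. fourier N f m * (?r * chi N (m * x) * cnj (f x)))"
    by (simp add: sum_distrib_left sum_distrib_right mult_ac)
  also have "\<dots> = (\<Sum>m\<in>ZN N. \<Sum>x\<in>ZN N. fourier N f m * (?r * chi N (m * x) * cnj (f x)))"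
    by (rule sum.swap)
  also have "\<dots> = (\<Sum>m\<in>ZN N. fourier N f m * cnj (fourier N f m))"
    by (simp add: fourier_def[of N f] cnj_chi sum_distrib_left sum_distrib_right mult_ac)
  also have "\<dots> = complex_of_real (\<Sum>m\<in>ZN N. (norm (fourier N f m))\<^sup>2)"
    by (simp only: complex_norm_square of_real_sum)
  finally show ?thesis
    by (metis of_real_eq_iff)
qed

section \<open>Approximation by trigonometric polynomials\<close>

lemma lp_norm_1: "lp_norm N 1 g = (\<Sum>x\<in>ZN N. norm (g x))"
  by (simp add: lp_norm_def sum_nonneg)

lemma lp_norm_2: "lp_norm N 2 g = sqrt (\<Sum>x\<in>ZN N. (norm (g x))\<^sup>2)"
  by (simp add: lp_norm_def powr_half_sqrt sum_nonneg)

lemma trigonometric_approximation: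
  fixes n :: nat
  assumes "N > 0" "\<exists>x\<in>ZN N. f x \<noteq> 0" "n > 0"
  defines "A \<equiv> \<Sum>m\<in>ZN N. norm (fourier N f m)"
  shows "\<exists>c m. (\<forall>j. m j \<in> ZN N) \<and>
    (\<Sum>x\<in>ZN N. (norm (f x - (\<Sum>j<n. c j * chi N (m j * x))))\<^sup>2)
      \<le> (A\<^sup>2 - (\<Sum>x\<in>ZN N. (norm (f x))\<^sup>2)) / real n"
proof -
  define a where "a = fourier N f"
  define r where "r = real N powr (- 1 / 2)"
  define v where "v m x = of_real (A * r) * sgn (a m) * chi N (m * x)" for m x
  \<comment> \<open>If all coefficients vanished, inversion would give \<open>f = 0\<close> on
    \<open>ZN N\<close>. Hence the weights \<open>norm (a m) / A\<close> are well defined.\<close>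
  have "\<exists>m\<in>ZN N. a m \<noteq> 0"
    using assms(2) fourier_inversion[OF assms(1), of _ f]
    by (metis (no_types, lifting) a_def mult_eq_0_iff sum.neutral)
  then have A: "A > 0"
    unfolding A_def by (auto simp: a_def intro: sum_pos2)
  have f: "f x = (\<Sum>m\<in>ZN N. (norm (a m) / A) *\<^sub>R v m x)" if "x \<in> ZN N" for x
  proof -
    have "(norm (a m) / A) *\<^sub>R v m x = of_real r * (a m * chi N (m * x))" for m
      using A by (simp add: v_def scaleR_conv_of_real sgn_eq)
    then show ?thesis
      using fourier_inversion[OF assms(1) that, of f] by (simp add: a_def r_def sum_distrib_left)
  qed
  have bound: "(\<Sum>x\<in>ZN N. (norm (v m x))\<^sup>2) \<le> A\<^sup>2" for m
  proof -
    \<comment> \<open>Equality holds if \<open>a m\<close> is nonzero; otherwise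
      \<open>sgn (a m) = 0\<close> and the left side is 0.\<close>
    have "(norm (v m x))\<^sup>2 \<le> A\<^sup>2 / real N" for x
      using powr_minus_half_sq[OF assms(1)]
      by (simp add: v_def norm_mult norm_sgn power_mult_distrib r_def)
    then have "(\<Sum>x\<in>ZN N. (norm (v m x))\<^sup>2) \<le> (\<Sum>x\<in>ZN N. A\<^sup>2 / real N)"
      by (intro sum_mono)
    then show ?thesis
      using assms(1) by (simp add: ZN_eq)
  qed
  obtain m where m: "\<And>j. m j \<in> ZN N" and
    le: "(\<Sum>x\<in>ZN N. (norm (\<Sum>j<n. v (m j) x - f x))\<^sup>2)
           \<le> real n * (A\<^sup>2 - (\<Sum>x\<in>ZN N. (norm (f x))\<^sup>2))"
    using maurey_empirical[of "ZN N" "\<lambda>m. norm (a m) / A" "ZN N" f v "A\<^sup>2" n] A f bound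
    by (auto simp: a_def A_def simp flip: sum_divide_distrib)
  \<comment> \<open>The coefficients of the mean of the \<open>n\<close> samples. Averaging divides
    the squared error by the square of \<open>n\<close>, which turns the factor \<open>n\<close> in
    \<open>le\<close> into \<open>1 / n\<close>.\<close>
  define c where "c j = of_real (A * r) * sgn (a (m j)) / of_nat n" for j
  have "(norm (f x - (\<Sum>j<n. c j * chi N (m j * x))))\<^sup>2
      = (norm (\<Sum>j<n. v (m j) x - f x))\<^sup>2 / (real n)\<^sup>2" for x
  proof -
    have "f x - (\<Sum>j<n. c j * chi N (m j * x)) = - (\<Sum>j<n. v (m j) x - f x) / of_nat n"
      using assms(3) by (simp add: c_def v_def sum_subtractf sum_divide_distrib diff_divide_distrib)
    then show ?thesis
      by (simp add: norm_divide power_divide norm_minus_commute)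
  qed
  then have "(\<Sum>x\<in>ZN N. (norm (f x - (\<Sum>j<n. c j * chi N (m j * x))))\<^sup>2)
      = (\<Sum>x\<in>ZN N. (norm (\<Sum>j<n. v (m j) x - f x))\<^sup>2) / (real n)\<^sup>2"
    by (simp add: sum_divide_distrib)
  also have "\<dots> \<le> real n * (A\<^sup>2 - (\<Sum>x\<in>ZN N. (norm (f x))\<^sup>2)) / (real n)\<^sup>2"
    by (intro divide_right_mono le) simp
  also have "\<dots> = (A\<^sup>2 - (\<Sum>x\<in>ZN N. (norm (f x))\<^sup>2)) / real n"
    by (simp add: power2_eq_square)
  finally show ?thesis
    using m by blast
qed

theorem theorem1p15:
  fixes N :: nat and f :: "int \<Rightarrow> complex" and \<eta> :: real and k :: int
  assumes "N > 0"
    and "\<exists>x\<in>ZN N. f x \<noteq> 0"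
    and "\<eta> > 0"
    and "real_of_int k > ((fourier_ratio N f)\<^sup>2 - 1) / \<eta>\<^sup>2"
  shows "\<exists>(c :: int \<Rightarrow> complex) (m :: int \<Rightarrow> int).
           (\<forall>i\<in>{1..k}. m i \<in> ZN N) \<and>
           lp_norm N 2 (\<lambda>x. f x - (\<Sum>i=1..k. c i * chi N (m i * x))) < \<eta> * lp_norm N 2 f"
proof -
  define A where "A = (\<Sum>m\<in>ZN N. norm (fourier N f m))"
  define E where "E = (\<Sum>x\<in>ZN N. (norm (f x))\<^sup>2)"
  have E: "E > 0"
    using assms(2) unfolding E_def by (auto intro: sum_pos2)
  have FR: "(fourier_ratio N f)\<^sup>2 = A\<^sup>2 / E"
    using E parseval[OF assms(1), of f]
    by (simp add: fourier_ratio_def lp_norm_1 lp_norm_2 power_divide A_def E_def)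
  \<comment> \<open>The 2-norm is at most the 1-norm, so the Fourier ratio is at least 1. This makes
    \<open>k\<close> positive, and \<open>nat k\<close> loses nothing.\<close>
  have "E \<le> A\<^sup>2"
    using L2_set_le_sum[of "ZN N" "\<lambda>m. norm (fourier N f m)"] parseval[OF assms(1), of f]
    by (simp add: L2_set_def A_def E_def sqrt_le_D)
  then have "((fourier_ratio N f)\<^sup>2 - 1) / \<eta>\<^sup>2 \<ge> 0"
    using E by (simp add: FR field_simps)
  then have k: "k > 0"
    using assms(4) by linarith
  define n where "n = nat k"
  have n: "n > 0" "real_of_int k = real n"
    using k by (simp_all add: n_def)
  obtain c m where m: "\<And>j. m j \<in> ZN N" and
    le: "(\<Sum>x\<in>ZN N. (norm (f x - (\<Sum>j<n. c j * chi N (m j * x))))\<^sup>2) \<le> (A\<^sup>2 - E) / real n"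
    using trigonometric_approximation[OF assms(1,2) n(1)] unfolding A_def E_def by blast
  \<comment> \<open>Shift from the indices \<open>1..k\<close> to
    \<open>0, ..., n - 1\<close>.\<close>
  have sum_eq: "(\<Sum>i=1..k. c (nat (i - 1)) * chi N (m (nat (i - 1)) * x)) = (\<Sum>j<n. c j * chi N (m j * x))" for x
    by (rule sum.reindex_bij_witness[of _ "\<lambda>j. int j + 1" "\<lambda>i. nat (i - 1)"]) (auto simp: n_def)
  \<comment> \<open>The assumed lower bound on \<open>k\<close>, multiplied out; the strict
    inequality of the conclusion comes from here.\<close>
  have "(A\<^sup>2 - E) / real n < \<eta>\<^sup>2 * E"
    using assms(3,4) n E by (simp add: FR field_simps)
  with le have "lp_norm N 2 (\<lambda>x. f x - (\<Sum>j<n. c j * chi N (m j * x))) < sqrt (\<eta>\<^sup>2 * E)"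
    unfolding lp_norm_2 by (intro real_sqrt_less_mono) linarith
  also have "\<dots> = \<eta> * lp_norm N 2 f"
    using assms(3) by (simp add: lp_norm_2 E_def real_sqrt_mult)
  finally show ?thesis
    using m by (intro exI[of _ "\<lambda>i. c (nat (i - 1))"] exI[of _ "\<lambda>i. m (nat (i - 1))"]) (simp add: sum_eq)
qed

end
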